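(* If $X$ is a majorizing sublattice of a uniformly complete vector lattice $Y$, then the uniform completion $X^{\mathrm{ru}}$ of $X$ is lattice isomorphic to the uniform closure of $X$ in $Y$.
   Context: All vector lattices are real and Archimedean. For a vector lattice $X$ and $e\in X_+$, a net $(x_\alpha)$ in $X$ converges to $x\in X$ uniformly relative to $e$ if for every $\varepsilon>0$ there is $\alpha_0$ with $|x_\alpha-x|\le\varepsilon e$ for all $\alpha\ge\alpha_0$; it converges (relatively) uniformly to $x$ in $X$ if this holds for some $e\in X_+$ (called a regulator). A net $(x_\alpha)_{\alpha\in\Lambda}$ is uniformly Cauchy in $X$ if the net $(x_\alpha-x_\beta)$ indexed by $\Lambda^2$ converges uniformly to $0$ in $X$. $X$ is uniformly complete if every uniformly Cauchy net in $X$ converges uniformly in $X$. A subset $A$ of $Y$ is uniformly closed in $Y$ if it contains the limits of all nets in $A$ that converge uniformly in $Y$; the uniform closure of $A$ in $Y$ is the intersection of all uniformly closed subsets of $Y$ containing $A$. A sublattice $X$ of $Y$ is majorizing if for every $y\in Y_+$ there is $x\in X$ with $y\le x$. $X^\delta$ denotes the order (Dedekind) completion of $X$. The uniform completion $X^{\mathrm{ru}}$ of $X$ is the intersection of all sublattices of $X^\delta$ that contain $X$ and are uniformly complete as vector lattices (it is itself such a sublattice). *)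

theory Defs
  imports "HOL-Analysis.Analysis" "HOL-Library.Lattice_Algebras" "HOL-Library.Lub_Glb"
begin

section \<open>Archimedean vector lattices and their sublattices\<close>

class archimedean_vector_lattice = ordered_real_vector + lattice_ab_group_add_abs +
  assumes archimedean: "(\<And>n::nat. real n *\<^sub>R x \<le> y) \<Longrightarrow> x \<le> 0"

text \<open>
  Vector lattices are represented by carriers: a vector sublattice \<open>S\<close> of an ambient type is
  itself an Archimedean vector lattice, and the notions below that refer to \<open>S\<close> are intrinsic to
  it (regulators, limits, suprema and bounds are taken in \<open>S\<close>). The choice \<open>S = UNIV\<close> gives a
  vector lattice that is a type of its own.
\<close>

definition vector_sublattice :: "'a::archimedean_vector_lattice set \<Rightarrow> bool" where
  "vector_sublattice S \<longleftrightarrow> subspace S \<and> (\<forall>x\<in>S. \<forall>y\<in>S. sup x y \<in> S \<and> inf x y \<in> S)"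

definition majorizing :: "'a::archimedean_vector_lattice set \<Rightarrow> 'a set \<Rightarrow> bool" where
  "majorizing X Y \<longleftrightarrow> (\<forall>y\<in>Y. 0 \<le> y \<longrightarrow> (\<exists>x\<in>X. y \<le> x))"

definition order_dense :: "'a::archimedean_vector_lattice set \<Rightarrow> 'a set \<Rightarrow> bool" where
  "order_dense X Y \<longleftrightarrow> (\<forall>y\<in>Y. 0 < y \<longrightarrow> (\<exists>x\<in>X. 0 < x \<and> x \<le> y))"

definition dedekind_complete :: "'a::archimedean_vector_lattice set \<Rightarrow> bool" where
  "dedekind_complete D \<longleftrightarrow>
     (\<forall>B\<subseteq>D. B \<noteq> {} \<and> (\<exists>u. isUb D B u) \<longrightarrow> (\<exists>s. isLub D B s))"

definition lattice_isomorphism ::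
  "('a::archimedean_vector_lattice \<Rightarrow> 'b::archimedean_vector_lattice) \<Rightarrow> 'a set \<Rightarrow> 'b set \<Rightarrow> bool"
where
  "lattice_isomorphism T A B \<longleftrightarrow> bij_betw T A B \<and>
     (\<forall>x\<in>A. \<forall>y\<in>A. T (x + y) = T x + T y) \<and>
     (\<forall>c. \<forall>x\<in>A. T (c *\<^sub>R x) = c *\<^sub>R T x) \<and>
     (\<forall>x\<in>A. \<forall>y\<in>A. T (sup x y) = sup (T x) (T y) \<and> T (inf x y) = inf (T x) (T y))"

definition lattice_isomorphic ::
  "'a::archimedean_vector_lattice set \<Rightarrow> 'b::archimedean_vector_lattice set \<Rightarrow> bool" where
  "lattice_isomorphic A B \<longleftrightarrow> (\<exists>T. lattice_isomorphism T A B)"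

text \<open>
  \<open>D\<close>, with the embedding \<open>J\<close> of \<open>X\<close>, is an order completion \<open>X\<^sup>\<delta>\<close> of \<open>X\<close>: a Dedekind complete
  vector lattice in which (the copy \<open>J ` X\<close> of) \<open>X\<close> is an order dense and majorizing sublattice.
  This determines \<open>(D, J)\<close> up to a lattice isomorphism over \<open>X\<close>.
\<close>

definition dedekind_completion ::
  "'a::archimedean_vector_lattice set \<Rightarrow> ('a \<Rightarrow> 'b::archimedean_vector_lattice) \<Rightarrow> 'b set \<Rightarrow> bool"
where
  "dedekind_completion X J D \<longleftrightarrow>
     vector_sublattice D \<and> dedekind_complete D \<and>
     J ` X \<subseteq> D \<and> lattice_isomorphism J X (J ` X) \<and>
     order_dense (J ` X) D \<and> majorizing (J ` X) D"


section \<open>Nets and relatively uniform convergence\<close>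

definition directed_set :: "'i set \<Rightarrow> ('i \<Rightarrow> 'i \<Rightarrow> bool) \<Rightarrow> bool" where
  "directed_set I r \<longleftrightarrow> I \<noteq> {} \<and> reflp_on I r \<and> transp_on I r \<and>
     (\<forall>a\<in>I. \<forall>b\<in>I. \<exists>c\<in>I. r a c \<and> r b c)"

text \<open>
  A net is given by its index set \<open>I\<close>, the relation \<open>r\<close> directing it (\<open>r a b\<close> stands for
  \<open>a \<le> b\<close>), and the function \<open>x\<close> on \<open>I\<close>.
\<close>

definition converges_relative_to ::
  "'a::archimedean_vector_lattice \<Rightarrow> 'i set \<Rightarrow> ('i \<Rightarrow> 'i \<Rightarrow> bool) \<Rightarrow> ('i \<Rightarrow> 'a) \<Rightarrow> 'a \<Rightarrow> bool" where
  "converges_relative_to e I r x l \<longleftrightarrow>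
     (\<forall>\<epsilon>>0. \<exists>a\<^sub>0\<in>I. \<forall>a\<in>I. r a\<^sub>0 a \<longrightarrow> \<bar>x a - l\<bar> \<le> \<epsilon> *\<^sub>R e)"

definition converges_uniformly_in ::
  "'a::archimedean_vector_lattice set \<Rightarrow> 'i set \<Rightarrow> ('i \<Rightarrow> 'i \<Rightarrow> bool) \<Rightarrow> ('i \<Rightarrow> 'a) \<Rightarrow> 'a \<Rightarrow> bool" where
  "converges_uniformly_in S I r x l \<longleftrightarrow>
     l \<in> S \<and> (\<exists>e\<in>S. 0 \<le> e \<and> converges_relative_to e I r x l)"

definition uniformly_Cauchy_in ::
  "'a::archimedean_vector_lattice set \<Rightarrow> 'i set \<Rightarrow> ('i \<Rightarrow> 'i \<Rightarrow> bool) \<Rightarrow> ('i \<Rightarrow> 'a) \<Rightarrow> bool" where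
  "uniformly_Cauchy_in S I r x \<longleftrightarrow>
     converges_uniformly_in S (I \<times> I) (rel_prod r r) (\<lambda>(a, b). x a - x b) 0"

text \<open>
  A formula cannot quantify over the types of index sets, so the next two definitions fix the
  index type \<open>'a \<times> 'a set\<close>. This type is large enough to contain, for every net in \<open>'a\<close>, the
  index set of an equivalent net: the pairs of a tail of the given net and a point in it. The
  lemmas \<open>uniformly_completeD\<close> and \<open>uniformly_closedD\<close> below show that both notions have their
  full strength, that is, for nets over arbitrary index types.
\<close>

definition uniformly_complete :: "'a::archimedean_vector_lattice set \<Rightarrow> bool" where
  "uniformly_complete S \<longleftrightarrow>
     (\<forall>(I :: ('a \<times> 'a set) set) r x.
        directed_set I r \<and> x ` I \<subseteq> S \<and> uniformly_Cauchy_in S I r x \<longrightarrow>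
        (\<exists>l. converges_uniformly_in S I r x l))"

definition uniformly_closed_in ::
  "'a::archimedean_vector_lattice set \<Rightarrow> 'a set \<Rightarrow> bool" where
  "uniformly_closed_in Y A \<longleftrightarrow> A \<subseteq> Y \<and>
     (\<forall>(I :: ('a \<times> 'a set) set) r x l.
        directed_set I r \<and> x ` I \<subseteq> A \<and> converges_uniformly_in Y I r x l \<longrightarrow> l \<in> A)"

definition uniform_closure_in ::
  "'a::archimedean_vector_lattice set \<Rightarrow> 'a set \<Rightarrow> 'a set" where
  "uniform_closure_in Y A = \<Inter>{C. uniformly_closed_in Y C \<and> A \<subseteq> C}"

text \<open>
  The uniform completion of \<open>X\<close>, formed inside a vector lattice \<open>D\<close> containing \<open>X\<close>; it is
  \<open>X\<^sup>r\<^sup>u\<close> when \<open>D\<close> is the order completion of \<open>X\<close>.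
\<close>

definition uniform_completion_in ::
  "'a::archimedean_vector_lattice set \<Rightarrow> 'a set \<Rightarrow> 'a set" where
  "uniform_completion_in D X =
     \<Inter>{S. vector_sublattice S \<and> X \<subseteq> S \<and> S \<subseteq> D \<and> uniformly_complete S}"


section \<open>Independence of the index type\<close>

definition net_tail :: "'i set \<Rightarrow> ('i \<Rightarrow> 'i \<Rightarrow> bool) \<Rightarrow> ('i \<Rightarrow> 'a) \<Rightarrow> 'i \<Rightarrow> 'a set" where
  "net_tail I r x a = x ` {b\<in>I. r a b}"

definition tail_index :: "'i set \<Rightarrow> ('i \<Rightarrow> 'i \<Rightarrow> bool) \<Rightarrow> ('i \<Rightarrow> 'a) \<Rightarrow> ('a \<times> 'a set) set" where
  "tail_index I r x = {(y, T). y \<in> T \<and> T \<in> net_tail I r x ` I}"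

definition tail_le :: "'a \<times> 'a set \<Rightarrow> 'a \<times> 'a set \<Rightarrow> bool" where
  "tail_le p q \<longleftrightarrow> snd q \<subseteq> snd p"

lemma net_tail_mono:
  assumes "directed_set I r" "a \<in> I" "c \<in> I" "r a c"
  shows "net_tail I r x c \<subseteq> net_tail I r x a"
  using assms unfolding directed_set_def net_tail_def
  by (auto intro!: imageI elim: transp_onD)

lemma mem_net_tail:
  assumes "directed_set I r" "a \<in> I"
  shows "x a \<in> net_tail I r x a"
  using assms unfolding directed_set_def net_tail_def by (auto dest: reflp_onD)

lemma directed_tail_index:
  assumes "directed_set I r"
  shows "directed_set (tail_index I r x) tail_le"
proof -
  have "\<exists>w\<in>tail_index I r x. tail_le p w \<and> tail_le q w"
    if pq: "p \<in> tail_index I r x" "q \<in> tail_index I r x" for p q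
  proof -
    obtain a b where ab: "a \<in> I" "b \<in> I" "snd p = net_tail I r x a" "snd q = net_tail I r x b"
      using pq by (auto simp: tail_index_def)
    obtain c where c: "c \<in> I" "r a c" "r b c"
      using assms ab unfolding directed_set_def by blast
    have "(x c, net_tail I r x c) \<in> tail_index I r x"
      using mem_net_tail[OF assms c(1)] c(1) by (auto simp: tail_index_def)
    moreover have "tail_le p (x c, net_tail I r x c)" "tail_le q (x c, net_tail I r x c)"
      using net_tail_mono[OF assms ab(1) c(1,2)] net_tail_mono[OF assms ab(2) c(1,3)] ab
      by (simp_all add: tail_le_def)
    ultimately show ?thesis by blast
  qed
  moreover have "tail_index I r x \<noteq> {}"
  proof -
    obtain a where a: "a \<in> I" using assms unfolding directed_set_def by blast
    have "(x a, net_tail I r x a) \<in> tail_index I r x"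
      using mem_net_tail[OF assms a] a by (auto simp: tail_index_def)
    then show ?thesis by blast
  qed
  moreover have "reflp_on (tail_index I r x) tail_le" "transp_on (tail_index I r x) tail_le"
    by (auto simp: reflp_on_def transp_on_def tail_le_def)
  ultimately show ?thesis
    unfolding directed_set_def by blast
qed

lemma tail_index_image:
  assumes "directed_set I r"
  shows "fst ` tail_index I r x = x ` I"
proof
  show "fst ` tail_index I r x \<subseteq> x ` I"
    by (auto simp: tail_index_def net_tail_def)
  show "x ` I \<subseteq> fst ` tail_index I r x"
  proof
    fix y assume "y \<in> x ` I"
    then obtain a where a: "a \<in> I" "y = x a" by blast
    then have "(y, net_tail I r x a) \<in> tail_index I r x"
      using mem_net_tail[OF assms a(1), of x] by (simp add: tail_index_def)
    then show "y \<in> fst ` tail_index I r x" by (metis fst_conv imageI)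
  qed
qed

lemma eventually_tail_index:
  assumes "directed_set I r"
  shows "(\<exists>p\<in>tail_index I r x. \<forall>q\<in>tail_index I r x. tail_le p q \<longrightarrow> P (fst q)) \<longleftrightarrow>
         (\<exists>a\<in>I. \<forall>b\<in>I. r a b \<longrightarrow> P (x b))" (is "?L \<longleftrightarrow> ?R")
proof
  assume ?L
  then obtain p where p: "p \<in> tail_index I r x"
    "\<And>q. q \<in> tail_index I r x \<Longrightarrow> tail_le p q \<Longrightarrow> P (fst q)" by blast
  obtain a where a: "a \<in> I" "snd p = net_tail I r x a"
    using p(1) by (auto simp: tail_index_def)
  have "P (x b)" if "b \<in> I" "r a b" for b
  proof -
    have "(x b, snd p) \<in> tail_index I r x"
      using that a by (auto simp: tail_index_def net_tail_def)
    then show ?thesis using p(2)[of "(x b, snd p)"] by (simp add: tail_le_def)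
  qed
  then show ?R using a(1) by blast
next
  assume ?R
  then obtain a where a: "a \<in> I" "\<And>b. b \<in> I \<Longrightarrow> r a b \<Longrightarrow> P (x b)" by blast
  have "(x a, net_tail I r x a) \<in> tail_index I r x"
    using mem_net_tail[OF assms a(1)] a(1) by (auto simp: tail_index_def)
  moreover have "P (fst q)"
    if "q \<in> tail_index I r x" "tail_le (x a, net_tail I r x a) q" for q
  proof -
    have "fst q \<in> net_tail I r x a"
      using that by (auto simp: tail_index_def tail_le_def)
    then show ?thesis using a(2) by (auto simp: net_tail_def)
  qed
  ultimately show ?L by blast
qed

lemma converges_tail_index:
  assumes "directed_set I r"
  shows "converges_uniformly_in S (tail_index I r x) tail_le fst l \<longleftrightarrow>
         converges_uniformly_in S I r x l"
  unfolding converges_uniformly_in_def converges_relative_to_def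
  by (simp only: eventually_tail_index[OF assms, where P = "\<lambda>y. \<bar>y - l\<bar> \<le> \<epsilon> *\<^sub>R e" for \<epsilon> e])

lemma uniformly_Cauchy_in_iff:
  assumes "directed_set I r"
  shows "uniformly_Cauchy_in S I r x \<longleftrightarrow> 0 \<in> S \<and>
    (\<exists>e\<in>S. 0 \<le> e \<and> (\<forall>\<epsilon>>0. \<exists>a\<in>I. \<forall>b\<in>I. \<forall>c\<in>I. r a b \<longrightarrow> r a c \<longrightarrow> \<bar>x b - x c\<bar> \<le> \<epsilon> *\<^sub>R e))"
proof -
  have "(\<exists>p\<in>I \<times> I. \<forall>q\<in>I \<times> I. rel_prod r r p q \<longrightarrow> \<bar>(case q of (a, b) \<Rightarrow> x a - x b) - 0\<bar> \<le> z) \<longleftrightarrow>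
        (\<exists>a\<in>I. \<forall>b\<in>I. \<forall>c\<in>I. r a b \<longrightarrow> r a c \<longrightarrow> \<bar>x b - x c\<bar> \<le> z)" (is "?L \<longleftrightarrow> ?R") for z
  proof
    assume ?L
    then obtain a a' where a: "a \<in> I" "a' \<in> I"
      "\<And>b c. b \<in> I \<Longrightarrow> c \<in> I \<Longrightarrow> r a b \<Longrightarrow> r a' c \<Longrightarrow> \<bar>x b - x c\<bar> \<le> z"
      by fastforce
    obtain d where d: "d \<in> I" "r a d" "r a' d"
      using assms a unfolding directed_set_def by blast
    have "r a b" "r a' b" if "b \<in> I" "r d b" for b
      using assms a(1,2) d that unfolding directed_set_def by (blast dest: transp_onD)+
    then show ?R using a(3) d(1) by blast
  next
    assume ?R
    then show ?L by fastforce
  qed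
  then show ?thesis
    unfolding uniformly_Cauchy_in_def converges_uniformly_in_def converges_relative_to_def by simp
qed

lemma uniformly_Cauchy_tail_index:
  assumes "directed_set I r" "uniformly_Cauchy_in S I r x"
  shows "uniformly_Cauchy_in S (tail_index I r x) tail_le fst"
proof -
  have "\<exists>p\<in>tail_index I r x. \<forall>q\<in>tail_index I r x. \<forall>q'\<in>tail_index I r x.
          tail_le p q \<longrightarrow> tail_le p q' \<longrightarrow> \<bar>fst q - fst q'\<bar> \<le> z"
    if a: "a \<in> I" "\<forall>b\<in>I. \<forall>c\<in>I. r a b \<longrightarrow> r a c \<longrightarrow> \<bar>x b - x c\<bar> \<le> z" for a z
  proof (intro bexI ballI impI)
    show "(x a, net_tail I r x a) \<in> tail_index I r x"
      using mem_net_tail[OF assms(1) a(1)] a(1) by (auto simp: tail_index_def)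
    fix q q' assume "q \<in> tail_index I r x" "q' \<in> tail_index I r x"
      "tail_le (x a, net_tail I r x a) q" "tail_le (x a, net_tail I r x a) q'"
    then have "fst q \<in> net_tail I r x a" "fst q' \<in> net_tail I r x a"
      by (auto simp: tail_index_def tail_le_def)
    then show "\<bar>fst q - fst q'\<bar> \<le> z"
      using a(2) by (auto simp: net_tail_def)
  qed
  moreover obtain e where "0 \<in> S" "e \<in> S" "0 \<le> e"
    "\<forall>\<epsilon>>0. \<exists>a\<in>I. \<forall>b\<in>I. \<forall>c\<in>I. r a b \<longrightarrow> r a c \<longrightarrow> \<bar>x b - x c\<bar> \<le> \<epsilon> *\<^sub>R e"
    using assms(2) unfolding uniformly_Cauchy_in_iff[OF assms(1)] by (elim conjE bexE)
  ultimately show ?thesis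
    unfolding uniformly_Cauchy_in_iff[OF directed_tail_index[OF assms(1)]]
    by (intro conjI bexI[of _ e] allI impI) (assumption | blast)+
qed

lemma uniformly_completeD:
  fixes I :: "'i set"
  assumes "uniformly_complete S" "directed_set I r" "x ` I \<subseteq> S" "uniformly_Cauchy_in S I r x"
  shows "\<exists>l. converges_uniformly_in S I r x l"
proof -
  have "\<exists>l. converges_uniformly_in S (tail_index I r x) tail_le fst l"
    using assms(1) directed_tail_index[OF assms(2), of x] tail_index_image[OF assms(2), of x]
      assms(3) uniformly_Cauchy_tail_index[OF assms(2,4)]
    unfolding uniformly_complete_def by blast
  then show ?thesis by (simp add: converges_tail_index[OF assms(2)])
qed

lemma uniformly_closedD:
  fixes I :: "'i set"
  assumes "uniformly_closed_in Y A" "directed_set I r" "x ` I \<subseteq> A"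
    "converges_uniformly_in Y I r x l"
  shows "l \<in> A"
proof -
  have "converges_uniformly_in Y (tail_index I r x) tail_le fst l"
    using assms(4) by (simp add: converges_tail_index[OF assms(2)])
  then show ?thesis
    using assms(1) directed_tail_index[OF assms(2), of x] tail_index_image[OF assms(2), of x]
      assms(3)
    unfolding uniformly_closed_in_def by blast
qed

end

theory Submission
  imports Defs
begin

text \<open>
  Let \<open>Z\<close> be the uniform closure of \<open>X\<close> in \<open>Y\<close>, and for \<open>z\<close> in \<open>Y\<close> let \<open>T z\<close> be the supremum in
  the order completion of all \<open>J x\<close> with \<open>x \<in> X\<close> and \<open>x \<le> z\<close>. This map is monotone and satisfies
  \<open>T (z + x) = T z + J x\<close> for \<open>x \<in> X\<close>; since \<open>X\<close> is majorizing, regulators can be taken in \<open>X\<close>, so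
  \<open>T\<close> preserves uniform convergence. A property that holds on \<open>X\<close> and passes to uniform limits
  holds on \<open>Z\<close>. In this way \<open>Z\<close> is a sublattice, \<open>T\<close> is a lattice homomorphism on \<open>Z\<close>, and
  \<open>T z \<le> J x\<close> implies \<open>z \<le> x\<close>, so that \<open>T\<close> is injective and reflects Cauchy nets. Hence \<open>T ` Z\<close> is
  uniformly complete, and it lies in every uniformly complete sublattice that contains \<open>J ` X\<close>.
\<close>

section \<open>Elementary facts on sublattices, moduli and the Archimedean property\<close>

lemma vector_sublattice_closed:
  assumes "vector_sublattice S"
  shows "0 \<in> S"
    and "x \<in> S \<Longrightarrow> y \<in> S \<Longrightarrow> x + y \<in> S"
    and "x \<in> S \<Longrightarrow> y \<in> S \<Longrightarrow> x - y \<in> S"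
    and "x \<in> S \<Longrightarrow> - x \<in> S"
    and "x \<in> S \<Longrightarrow> c *\<^sub>R x \<in> S"
    and "x \<in> S \<Longrightarrow> y \<in> S \<Longrightarrow> sup x y \<in> S"
    and "x \<in> S \<Longrightarrow> y \<in> S \<Longrightarrow> inf x y \<in> S"
    and "x \<in> S \<Longrightarrow> \<bar>x\<bar> \<in> S"
  using assms unfolding vector_sublattice_def
  by (auto simp: subspace_0 subspace_add subspace_diff subspace_neg subspace_scale abs_lattice)

text \<open>Modulus estimates are split into two one-sided inequalities because a monotone map can
  be applied to the latter directly.\<close>

lemma abs_diff_le_iff_both:
  fixes a b e :: "'a::archimedean_vector_lattice"
  shows "\<bar>a - b\<bar> \<le> e \<longleftrightarrow> a \<le> b + e \<and> b \<le> a + e"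
proof -
  have "\<bar>a - b\<bar> \<le> e \<longleftrightarrow> a - b \<le> e \<and> - (a - b) \<le> e"
    unfolding abs_lattice by (rule le_sup_iff)
  then show ?thesis by (simp add: diff_le_eq add.commute)
qed

text \<open>Taking \<epsilon> = 1/n and multiplying by n bounds every multiple of
  \<open>a - b\<close> by \<open>e\<close>; for n = 0 this is \<open>0 \<le> e\<close>. Uniqueness
  of uniform limits rests on this.\<close>

lemma archimedean_le:
  fixes a b e :: "'a::archimedean_vector_lattice"
  assumes "0 \<le> e" and le: "\<And>\<epsilon>::real. 0 < \<epsilon> \<Longrightarrow> a \<le> b + \<epsilon> *\<^sub>R e"
  shows "a \<le> b"
proof -
  have "real n *\<^sub>R (a - b) \<le> e" for n :: nat
  proof (cases "n = 0")
    case True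
    then show ?thesis using assms(1) by simp
  next
    case False
    then have "a - b \<le> (1 / real n) *\<^sub>R e"
      using le[of "1 / real n"] by (simp add: diff_le_eq add.commute)
    then have "real n *\<^sub>R (a - b) \<le> real n *\<^sub>R ((1 / real n) *\<^sub>R e)"
      by (intro scaleR_left_mono) auto
    then show ?thesis using False by simp
  qed
  from archimedean[OF this] show ?thesis by simp
qed


section \<open>Approximation relative to a regulator\<close>

text \<open>For \<open>0 \<le> e\<close> this says that \<open>l\<close> is a limit of elements of
  \<open>C\<close> uniformly relative to \<open>e\<close>. It mentions no index set, so that limits
  can be handled without carrying nets along.\<close>

definition approximable :: "'a::archimedean_vector_lattice \<Rightarrow> 'a set \<Rightarrow> 'a \<Rightarrow> bool" where
  "approximable e C l \<longleftrightarrow> (\<forall>\<epsilon>>0. \<exists>c\<in>C. c \<le> l + \<epsilon> *\<^sub>R e \<and> l \<le> c + \<epsilon> *\<^sub>R e)"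

lemma approximable_obtain:
  assumes "approximable e C l" "0 < \<epsilon>"
  obtains c where "c \<in> C" "c \<le> l + \<epsilon> *\<^sub>R e" "l \<le> c + \<epsilon> *\<^sub>R e"
  using assms unfolding approximable_def by blast

lemma approximable_mono:
  assumes "approximable e C l" "e \<le> e'" "C \<subseteq> C'"
  shows "approximable e' C' l"
  unfolding approximable_def
proof (intro allI impI)
  fix \<epsilon> :: real assume \<epsilon>: "0 < \<epsilon>"
  obtain c where c: "c \<in> C" "c \<le> l + \<epsilon> *\<^sub>R e" "l \<le> c + \<epsilon> *\<^sub>R e"
    using approximable_obtain[OF assms(1) \<epsilon>] .
  have "\<epsilon> *\<^sub>R e \<le> \<epsilon> *\<^sub>R e'"
    using assms(2) \<epsilon> by (simp add: scaleR_left_mono)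
  then have "c \<le> l + \<epsilon> *\<^sub>R e'" "l \<le> c + \<epsilon> *\<^sub>R e'"
    using c(2,3) by (meson add_left_mono order_trans)+
  then show "\<exists>c\<in>C'. c \<le> l + \<epsilon> *\<^sub>R e' \<and> l \<le> c + \<epsilon> *\<^sub>R e'"
    using c(1) assms(3) by blast
qed

lemma converges_imp_approximable:
  assumes "directed_set I r" "x ` I \<subseteq> C" "converges_relative_to e I r x l"
  shows "approximable e C l"
  unfolding approximable_def
proof (intro allI impI)
  fix \<epsilon> :: real assume "0 < \<epsilon>"
  then obtain a where a: "a \<in> I" "\<And>b. b \<in> I \<Longrightarrow> r a b \<Longrightarrow> \<bar>x b - l\<bar> \<le> \<epsilon> *\<^sub>R e"
    using assms(3) unfolding converges_relative_to_def by blast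
  have "r a a" using assms(1) a(1) by (auto simp: directed_set_def dest: reflp_onD)
  then have "\<bar>x a - l\<bar> \<le> \<epsilon> *\<^sub>R e" using a by blast
  then show "\<exists>c\<in>C. c \<le> l + \<epsilon> *\<^sub>R e \<and> l \<le> c + \<epsilon> *\<^sub>R e"
    unfolding abs_diff_le_iff_both using assms(2) a(1) by blast
qed

lemma directed_set_nat: "directed_set (UNIV :: nat set) (\<le>)"
  unfolding directed_set_def
  by (auto simp: reflp_on_def transp_on_def intro: max.cobounded1 max.cobounded2)

text \<open>With one fixed regulator, the tolerances 1/(n+1) already suffice, so countably many
  choices give a sequence.\<close>

lemma approximable_imp_sequence:
  assumes "approximable e C l" "0 \<le> e"
  obtains s :: "nat \<Rightarrow> 'a::archimedean_vector_lattice"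
  where "range s \<subseteq> C" "converges_relative_to e UNIV (\<le>) s l"
proof -
  have "\<forall>n. \<exists>c\<in>C. \<bar>c - l\<bar> \<le> (1 / real (Suc n)) *\<^sub>R e"
    using assms(1) unfolding abs_diff_le_iff_both approximable_def
    by (simp del: of_nat_Suc)
  then obtain s where s: "\<And>n. s n \<in> C" "\<And>n. \<bar>s n - l\<bar> \<le> (1 / real (Suc n)) *\<^sub>R e"
    by metis
  have "\<exists>n0. \<forall>n\<ge>n0. \<bar>s n - l\<bar> \<le> \<epsilon> *\<^sub>R e" if \<epsilon>: "0 < \<epsilon>" for \<epsilon>
  proof -
    obtain n0 where n0: "1 / real (Suc n0) < \<epsilon>" by (rule nat_approx_posE[OF \<epsilon>])
    have "\<bar>s n - l\<bar> \<le> \<epsilon> *\<^sub>R e" if "n0 \<le> n" for n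
    proof -
      have "1 / real (Suc n) \<le> 1 / real (Suc n0)" using that by (simp add: frac_le)
      then have "(1 / real (Suc n)) *\<^sub>R e \<le> \<epsilon> *\<^sub>R e"
        using n0 assms(2) by (intro scaleR_right_mono) auto
      then show ?thesis using s(2) order_trans by blast
    qed
    then show ?thesis by blast
  qed
  then have "converges_relative_to e UNIV (\<le>) s l"
    unfolding converges_relative_to_def by simp
  then show ?thesis using that s(1) by blast
qed

lemma uniformly_closed_in_approximable:
  assumes "uniformly_closed_in Y C" "l \<in> Y" "e \<in> Y" "0 \<le> e" "approximable e C l"
  shows "l \<in> C"
proof -
  obtain s :: "nat \<Rightarrow> 'a" where "range s \<subseteq> C" "converges_relative_to e UNIV (\<le>) s l"
    using approximable_imp_sequence[OF assms(5,4)] .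
  then show ?thesis
    using uniformly_closedD[OF assms(1) directed_set_nat] assms(2-4)
    unfolding converges_uniformly_in_def by blast
qed

text \<open>Completeness is intrinsic to \<open>S\<close>, whereas \<open>d\<close> is only known to
  lie in the ambient type. An approximating sequence is Cauchy in \<open>S\<close>, so it has a
  limit in \<open>S\<close>, and the Archimedean property identifies that limit with
  \<open>d\<close>.\<close>

lemma uniformly_complete_approximable:
  assumes S: "vector_sublattice S" "uniformly_complete S"
    and e: "e \<in> S" "0 \<le> e" and appr: "approximable e S d"
  shows "d \<in> S"
proof -
  obtain s :: "nat \<Rightarrow> 'a" where s: "range s \<subseteq> S" "converges_relative_to e UNIV (\<le>) s d"
    using approximable_imp_sequence[OF appr e(2)] .
  have "uniformly_Cauchy_in S UNIV (\<le>) s"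
    unfolding uniformly_Cauchy_in_iff[OF directed_set_nat]
  proof (intro conjI bexI[OF _ e(1)] allI impI)
    fix \<epsilon> :: real assume "0 < \<epsilon>"
    then have "0 < \<epsilon> / 2" by simp
    then obtain n0 where n0: "\<And>n. n0 \<le> n \<Longrightarrow> \<bar>s n - d\<bar> \<le> (\<epsilon> / 2) *\<^sub>R e"
      using s(2) unfolding converges_relative_to_def by blast
    have "\<bar>s b - s c\<bar> \<le> \<epsilon> *\<^sub>R e" if "n0 \<le> b" "n0 \<le> c" for b c
    proof -
      have "\<bar>s b - s c\<bar> \<le> \<bar>s b - d\<bar> + \<bar>s c - d\<bar>"
        using abs_triangle_ineq4[of "s b - d" "s c - d"] by simp
      also have "\<dots> \<le> (\<epsilon> / 2) *\<^sub>R e + (\<epsilon> / 2) *\<^sub>R e"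
        by (intro add_mono n0 that)
      also have "\<dots> = \<epsilon> *\<^sub>R e" by (simp flip: scaleR_add_left)
      finally show ?thesis .
    qed
    then show "\<exists>a\<in>UNIV. \<forall>b\<in>UNIV. \<forall>c\<in>UNIV. a \<le> b \<longrightarrow> a \<le> c \<longrightarrow> \<bar>s b - s c\<bar> \<le> \<epsilon> *\<^sub>R e"
      by blast
  qed (use e vector_sublattice_closed(1)[OF S(1)] in auto)
  then obtain l e' where l: "l \<in> S" and e': "0 \<le> e'" "converges_relative_to e' UNIV (\<le>) s l"
    using uniformly_completeD[OF S(2) directed_set_nat s(1)]
    unfolding converges_uniformly_in_def by blast
  \<comment> \<open>The limit \<open>l\<close> comes with its own regulator \<open>e'\<close>,
    unrelated to \<open>e\<close>; the two limits are compared relative to the sum.\<close>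
  have "d \<le> l + \<epsilon> *\<^sub>R (e + e') \<and> l \<le> d + \<epsilon> *\<^sub>R (e + e')" if \<epsilon>: "0 < \<epsilon>" for \<epsilon>
  proof -
    obtain n1 where n1: "\<And>n. n1 \<le> n \<Longrightarrow> \<bar>s n - d\<bar> \<le> \<epsilon> *\<^sub>R e"
      using s(2) \<epsilon> unfolding converges_relative_to_def by blast
    obtain n2 where n2: "\<And>n. n2 \<le> n \<Longrightarrow> \<bar>s n - l\<bar> \<le> \<epsilon> *\<^sub>R e'"
      using e'(2) \<epsilon> unfolding converges_relative_to_def by blast
    let ?n = "max n1 n2"
    have "\<bar>d - l\<bar> \<le> \<bar>s ?n - l\<bar> + \<bar>s ?n - d\<bar>"
      using abs_triangle_ineq4[of "s ?n - l" "s ?n - d"] by simp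
    also have "\<dots> \<le> \<epsilon> *\<^sub>R e' + \<epsilon> *\<^sub>R e"
      by (intro add_mono n1 n2) auto
    finally show ?thesis
      unfolding abs_diff_le_iff_both by (simp add: scaleR_add_right add.commute)
  qed
  then have "d \<le> l" "l \<le> d"
    using archimedean_le[of "e + e'"] e(2) e'(1) by (metis add_nonneg_nonneg)+
  then show ?thesis using l by simp
qed


section \<open>Maps that preserve relative approximation\<close>

text \<open>\<open>R\<close> and \<open>R'\<close> hold the admissible regulators, separately from
  the domain \<open>Z\<close>. One \<open>e'\<close> serves all points and all \<epsilon>, as in a
  Lipschitz condition. The hypotheses are symmetric in \<open>a\<close> and \<open>b\<close>, so
  exchanging these gives the reverse inequality.\<close>

definition ru_continuous_on ::
  "'a::archimedean_vector_lattice set \<Rightarrow> 'a set \<Rightarrow> 'b::archimedean_vector_lattice set \<Rightarrow>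
    ('a \<Rightarrow> 'b) \<Rightarrow> bool" where
  "ru_continuous_on R Z R' f \<longleftrightarrow> (\<forall>e\<in>R. 0 \<le> e \<longrightarrow> (\<exists>e'\<in>R'. 0 \<le> e' \<and>
     (\<forall>a\<in>Z. \<forall>b\<in>Z. \<forall>\<epsilon>>0. a \<le> b + \<epsilon> *\<^sub>R e \<longrightarrow> b \<le> a + \<epsilon> *\<^sub>R e \<longrightarrow> f a \<le> f b + \<epsilon> *\<^sub>R e')))"

lemma ru_continuous_on_obtain:
  assumes "ru_continuous_on R Z R' f" "e \<in> R" "0 \<le> e"
  obtains e' where "e' \<in> R'" "0 \<le> e'"
    "\<And>a b \<epsilon>. \<lbrakk>a \<in> Z; b \<in> Z; 0 < \<epsilon>; a \<le> b + \<epsilon> *\<^sub>R e; b \<le> a + \<epsilon> *\<^sub>R e\<rbrakk> \<Longrightarrow> f a \<le> f b + \<epsilon> *\<^sub>R e'"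
  using assms unfolding ru_continuous_on_def by blast

lemma ru_continuous_on_compose:
  assumes f: "ru_continuous_on R Z R' f" and fZ: "f ` Z \<subseteq> Z'"
    and g: "ru_continuous_on R' Z' R'' g"
  shows "ru_continuous_on R Z R'' (\<lambda>z. g (f z))"
  unfolding ru_continuous_on_def
proof (intro ballI impI)
  fix e assume e: "e \<in> R" "0 \<le> e"
  obtain e' where e': "e' \<in> R'" "0 \<le> e'" "\<And>a b \<epsilon>. \<lbrakk>a \<in> Z; b \<in> Z; 0 < \<epsilon>; a \<le> b + \<epsilon> *\<^sub>R e;
      b \<le> a + \<epsilon> *\<^sub>R e\<rbrakk> \<Longrightarrow> f a \<le> f b + \<epsilon> *\<^sub>R e'"
    using ru_continuous_on_obtain[OF f e] by metis
  obtain e'' where e'': "e'' \<in> R''" "0 \<le> e''" "\<And>a b \<epsilon>. \<lbrakk>a \<in> Z'; b \<in> Z'; 0 < \<epsilon>;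
      a \<le> b + \<epsilon> *\<^sub>R e'; b \<le> a + \<epsilon> *\<^sub>R e'\<rbrakk> \<Longrightarrow> g a \<le> g b + \<epsilon> *\<^sub>R e''"
    using ru_continuous_on_obtain[OF g e'(1,2)] by metis
  show "\<exists>e''\<in>R''. 0 \<le> e'' \<and> (\<forall>a\<in>Z. \<forall>b\<in>Z. \<forall>\<epsilon>>0. a \<le> b + \<epsilon> *\<^sub>R e \<longrightarrow> b \<le> a + \<epsilon> *\<^sub>R e \<longrightarrow>
      g (f a) \<le> g (f b) + \<epsilon> *\<^sub>R e'')"
    using e''(1,2) fZ by (intro bexI[of _ e''] conjI ballI allI impI e''(3) e'(3)) auto
qed

lemma ru_continuous_on_add: "ru_continuous_on R Z R (\<lambda>z. z + w)"
  unfolding ru_continuous_on_def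
proof (intro ballI impI)
  fix e assume "e \<in> R" "0 \<le> e"
  then show "\<exists>e'\<in>R. 0 \<le> e' \<and> (\<forall>a\<in>Z. \<forall>b\<in>Z. \<forall>\<epsilon>>0. a \<le> b + \<epsilon> *\<^sub>R e \<longrightarrow> b \<le> a + \<epsilon> *\<^sub>R e \<longrightarrow>
      a + w \<le> b + w + \<epsilon> *\<^sub>R e')"
    by (intro bexI[of _ e]) (auto simp: add.commute add.left_commute)
qed

lemma ru_continuous_on_sup: "ru_continuous_on R Z R (\<lambda>z. sup z w)"
  unfolding ru_continuous_on_def
proof (intro ballI impI)
  fix e assume e: "e \<in> R" "0 \<le> e"
  have "sup a w \<le> sup b w + \<epsilon> *\<^sub>R e" if "0 < \<epsilon>" "a \<le> b + \<epsilon> *\<^sub>R e" for a b and \<epsilon> :: real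
  proof (rule sup_least)
    show "a \<le> sup b w + \<epsilon> *\<^sub>R e"
      using that(2) by (meson add_right_mono order_trans sup_ge1)
    have "0 \<le> \<epsilon> *\<^sub>R e" using that(1) e(2) by (simp add: scaleR_nonneg_nonneg)
    then show "w \<le> sup b w + \<epsilon> *\<^sub>R e" by (simp add: add_increasing2)
  qed
  then show "\<exists>e'\<in>R. 0 \<le> e' \<and> (\<forall>a\<in>Z. \<forall>b\<in>Z. \<forall>\<epsilon>>0. a \<le> b + \<epsilon> *\<^sub>R e \<longrightarrow> b \<le> a + \<epsilon> *\<^sub>R e \<longrightarrow>
      sup a w \<le> sup b w + \<epsilon> *\<^sub>R e')"
    using e by (intro bexI[of _ e]) auto
qed

lemma ru_continuous_on_scaleR:
  assumes "vector_sublattice R"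
  shows "ru_continuous_on R Z R (\<lambda>z. c *\<^sub>R z)"
  unfolding ru_continuous_on_def
proof (intro ballI impI)
  fix e assume e: "e \<in> R" "0 \<le> e"
  have "c *\<^sub>R a \<le> c *\<^sub>R b + \<epsilon> *\<^sub>R (\<bar>c\<bar> *\<^sub>R e)"
    if ab: "a \<le> b + \<epsilon> *\<^sub>R e" "b \<le> a + \<epsilon> *\<^sub>R e" for a b and \<epsilon> :: real
  proof (cases "0 \<le> c")
    case True
    then have "c *\<^sub>R a \<le> c *\<^sub>R (b + \<epsilon> *\<^sub>R e)" using ab(1) by (rule scaleR_left_mono[rotated])
    then show ?thesis using True by (simp add: scaleR_add_right mult.commute)
  next
    \<comment> \<open>A negative factor reverses the order, so here the second of the two hypotheses
      gives the bound.\<close>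
    case False
    then have "(- c) *\<^sub>R b \<le> (- c) *\<^sub>R (a + \<epsilon> *\<^sub>R e)"
      using ab(2) by (intro scaleR_left_mono) auto
    then have "c *\<^sub>R a \<le> c *\<^sub>R b - (c * \<epsilon>) *\<^sub>R e"
      by (simp add: scaleR_add_right algebra_simps)
    then show ?thesis using False by (simp add: mult.commute)
  qed
  moreover have "\<bar>c\<bar> *\<^sub>R e \<in> R" "0 \<le> \<bar>c\<bar> *\<^sub>R e"
    using e vector_sublattice_closed(5)[OF assms] by (auto simp: scaleR_nonneg_nonneg)
  ultimately show "\<exists>e'\<in>R. 0 \<le> e' \<and> (\<forall>a\<in>Z. \<forall>b\<in>Z. \<forall>\<epsilon>>0. a \<le> b + \<epsilon> *\<^sub>R e \<longrightarrow>
      b \<le> a + \<epsilon> *\<^sub>R e \<longrightarrow> c *\<^sub>R a \<le> c *\<^sub>R b + \<epsilon> *\<^sub>R e')"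
    by blast
qed

lemma approximable_image:
  assumes f: "ru_continuous_on R Z R' f" and e: "e \<in> R" "0 \<le> e"
    and C: "C \<subseteq> Z" and l: "l \<in> Z" and appr: "approximable e C l"
  obtains e' where "e' \<in> R'" "0 \<le> e'" "approximable e' (f ` C) (f l)"
proof -
  obtain e' where e': "e' \<in> R'" "0 \<le> e'" "\<And>a b \<epsilon>. \<lbrakk>a \<in> Z; b \<in> Z; 0 < \<epsilon>; a \<le> b + \<epsilon> *\<^sub>R e;
      b \<le> a + \<epsilon> *\<^sub>R e\<rbrakk> \<Longrightarrow> f a \<le> f b + \<epsilon> *\<^sub>R e'"
    using ru_continuous_on_obtain[OF f e] by metis
  have "approximable e' (f ` C) (f l)"
    unfolding approximable_def
  proof (intro allI impI)
    fix \<epsilon> :: real assume \<epsilon>: "0 < \<epsilon>"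
    obtain c where "c \<in> C" "c \<le> l + \<epsilon> *\<^sub>R e" "l \<le> c + \<epsilon> *\<^sub>R e"
      using approximable_obtain[OF appr \<epsilon>] .
    then show "\<exists>d\<in>f ` C. d \<le> f l + \<epsilon> *\<^sub>R e' \<and> f l \<le> d + \<epsilon> *\<^sub>R e'"
      using e'(3) \<epsilon> C l by blast
  qed
  then show ?thesis using that e'(1,2) by blast
qed

text \<open>Both \<open>f l\<close> and \<open>g l\<close> are close to the common value at a nearby
  point \<open>c\<close>, relative to \<open>e1\<close> and \<open>e2\<close> respectively; the
  Archimedean property for \<open>e1 + e2\<close> then gives equality.\<close>

lemma ru_continuous_on_eq:
  assumes f: "ru_continuous_on R Z R' f" and g: "ru_continuous_on R Z R'' g"
    and e: "e \<in> R" "0 \<le> e" and l: "l \<in> Z" and appr: "approximable e {c \<in> Z. f c = g c} l"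
  shows "f l = g l"
proof -
  obtain e1 where e1: "0 \<le> e1" "\<And>a b \<epsilon>. \<lbrakk>a \<in> Z; b \<in> Z; 0 < \<epsilon>; a \<le> b + \<epsilon> *\<^sub>R e;
      b \<le> a + \<epsilon> *\<^sub>R e\<rbrakk> \<Longrightarrow> f a \<le> f b + \<epsilon> *\<^sub>R e1"
    using ru_continuous_on_obtain[OF f e] by metis
  obtain e2 where e2: "0 \<le> e2" "\<And>a b \<epsilon>. \<lbrakk>a \<in> Z; b \<in> Z; 0 < \<epsilon>; a \<le> b + \<epsilon> *\<^sub>R e;
      b \<le> a + \<epsilon> *\<^sub>R e\<rbrakk> \<Longrightarrow> g a \<le> g b + \<epsilon> *\<^sub>R e2"
    using ru_continuous_on_obtain[OF g e] by metis
  have "f l \<le> g l + \<epsilon> *\<^sub>R (e1 + e2) \<and> g l \<le> f l + \<epsilon> *\<^sub>R (e1 + e2)" if \<epsilon>: "0 < \<epsilon>" for \<epsilon>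
  proof -
    obtain c where c: "c \<in> Z" "f c = g c" "c \<le> l + \<epsilon> *\<^sub>R e" "l \<le> c + \<epsilon> *\<^sub>R e"
      using approximable_obtain[OF appr \<epsilon>] by blast
    have "f l \<le> g c + \<epsilon> *\<^sub>R e1" "g c \<le> f l + \<epsilon> *\<^sub>R e1"
      using e1(2)[OF l c(1) \<epsilon> c(4,3)] e1(2)[OF c(1) l \<epsilon> c(3,4)] c(2) by simp_all
    moreover have "g c \<le> g l + \<epsilon> *\<^sub>R e2" "g l \<le> g c + \<epsilon> *\<^sub>R e2"
      using e2(2)[OF l c(1) \<epsilon> c(4,3)] e2(2)[OF c(1) l \<epsilon> c(3,4)] by simp_all
    ultimately have "f l \<le> (g l + \<epsilon> *\<^sub>R e2) + \<epsilon> *\<^sub>R e1" "g l \<le> (f l + \<epsilon> *\<^sub>R e1) + \<epsilon> *\<^sub>R e2"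
      by (meson add_right_mono order_trans)+
    then show ?thesis by (simp add: scaleR_add_right add_ac)
  qed
  then have "f l \<le> g l" "g l \<le> f l"
    using archimedean_le[of "e1 + e2"] e1(1) e2(1) by (metis add_nonneg_nonneg)+
  then show ?thesis by simp
qed


section \<open>The uniform closure of a majorizing sublattice\<close>

lemma uniformly_closed_in_Inter:
  assumes "\<A> \<noteq> {}" "\<And>C. C \<in> \<A> \<Longrightarrow> uniformly_closed_in Y C"
  shows "uniformly_closed_in Y (\<Inter>\<A>)"
  unfolding uniformly_closed_in_def
proof (intro conjI allI impI)
  show "\<Inter>\<A> \<subseteq> Y"
    using assms unfolding uniformly_closed_in_def by blast
next
  fix I :: "('a \<times> 'a set) set" and r x l
  assume net: "directed_set I r \<and> x ` I \<subseteq> \<Inter>\<A> \<and> converges_uniformly_in Y I r x l"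
  then have "l \<in> C" if "C \<in> \<A>" for C
    using uniformly_closedD[OF assms(2)[OF that]] that by blast
  then show "l \<in> \<Inter>\<A>" by blast
qed

text \<open>\<open>Y\<close> is uniformly closed in itself, so the family being intersected is
  nonempty.\<close>

lemma uniformly_closed_in_uniform_closure:
  assumes "A \<subseteq> Y"
  shows "uniformly_closed_in Y (uniform_closure_in Y A)"
proof -
  have "uniformly_closed_in Y Y"
    unfolding uniformly_closed_in_def converges_uniformly_in_def by blast
  then show ?thesis
    unfolding uniform_closure_in_def using assms
    by (intro uniformly_closed_in_Inter) auto
qed

locale majorizing_sublattice =
  fixes X Y :: "'a::archimedean_vector_lattice set"
  assumes X: "vector_sublattice X" and Y: "vector_sublattice Y"
    and XY: "X \<subseteq> Y" and major: "majorizing X Y"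
begin

definition Z where "Z = uniform_closure_in Y X"

lemma closed_Z: "uniformly_closed_in Y Z"
  unfolding Z_def by (rule uniformly_closed_in_uniform_closure[OF XY])

lemma Z_subset: "Z \<subseteq> Y"
  using closed_Z unfolding uniformly_closed_in_def by blast

lemma X_subset_Z: "X \<subseteq> Z"
  unfolding Z_def uniform_closure_in_def by blast

lemma approximable_Z:
  assumes "e \<in> X" "0 \<le> e" "l \<in> Y" "approximable e Z l"
  shows "l \<in> Z"
  using uniformly_closed_in_approximable[OF closed_Z assms(3) _ assms(2,4)] assms(1) XY by blast

text \<open>A majorant of the modulus bounds \<open>y\<close> from both sides. It serves to move
  regulators from \<open>Y\<close> into \<open>X\<close>, and later to bound the sets whose suprema
  define \<open>T\<close>.\<close>

lemma majorant:
  assumes "y \<in> Y"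
  obtains x where "x \<in> X" "0 \<le> x" "y \<le> x" "- x \<le> y"
proof -
  have "\<bar>y\<bar> \<in> Y" using vector_sublattice_closed(8)[OF Y assms] .
  then obtain x where x: "x \<in> X" "\<bar>y\<bar> \<le> x"
    using major unfolding majorizing_def by (meson abs_ge_zero)
  moreover have "0 \<le> x" using x(2) abs_ge_zero order_trans by blast
  moreover have "y \<le> x" using x(2) abs_ge_self order_trans by blast
  moreover have "- x \<le> y" using x(2) abs_ge_minus_self[of y] by (meson minus_le_iff order_trans)
  ultimately show ?thesis using that by blast
qed

text \<open>The elements of \<open>Z\<close> with property \<open>P\<close> form a uniformly closed
  set containing \<open>X\<close>, so by minimality of the closure they exhaust \<open>Z\<close>. No
  description of \<open>Z\<close> by iterated limits is required.\<close>

lemma closure_induct [consumes 1, case_names base limit]: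
  assumes "z \<in> Z" and base: "\<And>x. x \<in> X \<Longrightarrow> P x"
    and limit: "\<And>e l. \<lbrakk>e \<in> X; 0 \<le> e; l \<in> Z; approximable e {c \<in> Z. P c} l\<rbrakk> \<Longrightarrow> P l"
  shows "P z"
proof -
  have "uniformly_closed_in Y {c \<in> Z. P c}"
    unfolding uniformly_closed_in_def
  proof (intro conjI allI impI)
    show "{c \<in> Z. P c} \<subseteq> Y" using Z_subset by blast
  next
    fix I :: "('a \<times> 'a set) set" and r x l
    assume net: "directed_set I r \<and> x ` I \<subseteq> {c \<in> Z. P c} \<and> converges_uniformly_in Y I r x l"
    then obtain e where e: "e \<in> Y" "converges_relative_to e I r x l"
      unfolding converges_uniformly_in_def by blast
    \<comment> \<open>The regulator of the net lies in \<open>Y\<close>; majorization enlarges it to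
      one in \<open>X\<close>.\<close>
    obtain e' where e': "e' \<in> X" "0 \<le> e'" "e \<le> e'" using majorant[OF e(1)] by blast
    have "l \<in> Z" using uniformly_closedD[OF closed_Z, of I r x l] net by blast
    moreover have "approximable e' {c \<in> Z. P c} l"
      using converges_imp_approximable[OF _ _ e(2)] net approximable_mono[OF _ e'(3)] by blast
    ultimately show "l \<in> {c \<in> Z. P c}" using limit[OF e'(1,2)] by blast
  qed
  then have "Z \<subseteq> {c \<in> Z. P c}"
    using X_subset_Z base unfolding Z_def uniform_closure_in_def by blast
  then show ?thesis using assms(1) by blast
qed

text \<open>If \<open>f\<close> maps the approximants of \<open>l\<close> into \<open>Z\<close>,
  continuity makes \<open>f l\<close> a uniform limit of elements of \<open>Z\<close>, and
  \<open>Z\<close> is closed.\<close>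

lemma Z_closed_under:
  assumes f: "ru_continuous_on X Z X f" and fY: "\<And>z. z \<in> Y \<Longrightarrow> f z \<in> Y"
    and fX: "\<And>x. x \<in> X \<Longrightarrow> f x \<in> Z" and z: "z \<in> Z"
  shows "f z \<in> Z"
  using z
proof (induction rule: closure_induct)
  case (limit e l)
  obtain e' where e': "e' \<in> X" "0 \<le> e'" "approximable e' (f ` {c \<in> Z. f c \<in> Z}) (f l)"
    using approximable_image[OF f limit(1,2) _ limit(3,4)] by blast
  have "approximable e' Z (f l)"
    by (rule approximable_mono[OF e'(3)]) auto
  then show ?case
    using approximable_Z[OF e'(1,2)] fY limit(3) Z_subset by blast
qed (rule fX)

text \<open>This is how identities are transferred from \<open>X\<close> to \<open>Z\<close>:
  agreement of two continuous maps survives uniform limits.\<close>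

lemma eq_on_Z:
  assumes f: "ru_continuous_on X Z R' f" and g: "ru_continuous_on X Z R'' g"
    and "\<And>x. x \<in> X \<Longrightarrow> f x = g x" and z: "z \<in> Z"
  shows "f z = g z"
  using z
proof (induction rule: closure_induct)
  case (limit e l)
  then show ?case using ru_continuous_on_eq[OF f g] by blast
qed (rule assms(3))

text \<open>
  For a binary operation, first let one argument range over \<open>Z\<close> with the other one fixed in \<open>X\<close>; by
  symmetry this is the base case when the other one is fixed in \<open>Z\<close>.
\<close>

lemma add_Z: assumes "z \<in> Z" "w \<in> Z" shows "z + w \<in> Z"
proof -
  have *: "z + x \<in> Z" if "z \<in> Z" "x \<in> X" for z x
    by (rule Z_closed_under[OF ru_continuous_on_add _ _ that(1)])
      (use that X_subset_Z XY vector_sublattice_closed(2)[OF X] vector_sublattice_closed(2)[OF Y] in blast)+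
  have **: "x + w \<in> Z" if "x \<in> X" for x
    using *[OF assms(2) that] by (simp add: add.commute)
  show ?thesis
    by (rule Z_closed_under[OF ru_continuous_on_add _ _ assms(1)])
      (use assms(2) Z_subset ** vector_sublattice_closed(2)[OF Y] in blast)+
qed

lemma scaleR_Z: assumes "z \<in> Z" shows "c *\<^sub>R z \<in> Z"
  by (rule Z_closed_under[OF ru_continuous_on_scaleR[OF X] _ _ assms])
    (use X_subset_Z vector_sublattice_closed(5)[OF X] vector_sublattice_closed(5)[OF Y] in blast)+

lemma sup_Z: assumes "z \<in> Z" "w \<in> Z" shows "sup z w \<in> Z"
proof -
  have *: "sup z x \<in> Z" if "z \<in> Z" "x \<in> X" for z x
    by (rule Z_closed_under[OF ru_continuous_on_sup _ _ that(1)])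
      (use that X_subset_Z XY vector_sublattice_closed(6)[OF X] vector_sublattice_closed(6)[OF Y] in blast)+
  have **: "sup x w \<in> Z" if "x \<in> X" for x
    using *[OF assms(2) that] by (simp add: sup.commute)
  show ?thesis
    by (rule Z_closed_under[OF ru_continuous_on_sup _ _ assms(1)])
      (use assms(2) Z_subset ** vector_sublattice_closed(6)[OF Y] in blast)+
qed

text \<open>Infima reduce to suprema by negation, which spares a further limit argument.\<close>

lemma vector_sublattice_Z: "vector_sublattice Z"
proof -
  have neg: "- u \<in> Z" if "u \<in> Z" for u
    using scaleR_Z[OF that, of "-1"] by simp
  have "inf z w \<in> Z" if "z \<in> Z" "w \<in> Z" for z w
    unfolding inf_eq_neg_sup using that by (intro neg sup_Z)
  moreover have "0 \<in> Z" using X_subset_Z vector_sublattice_closed(1)[OF X] by blast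
  ultimately show ?thesis
    unfolding vector_sublattice_def by (auto intro!: subspaceI add_Z scaleR_Z sup_Z)
qed

end

section \<open>Extending the embedding into the order completion\<close>

text \<open>The map constructed below starts in the closure and ends in the completion; the
  isomorphism asked for goes the other way.\<close>

lemma lattice_isomorphism_inv_into:
  assumes "lattice_isomorphism T A B" and A: "vector_sublattice A"
  shows "lattice_isomorphism (inv_into A T) B A"
proof -
  have bij: "bij_betw T A B"
    and T: "\<And>x y. x \<in> A \<Longrightarrow> y \<in> A \<Longrightarrow> T (x + y) = T x + T y"
      "\<And>c x. x \<in> A \<Longrightarrow> T (c *\<^sub>R x) = c *\<^sub>R T x"
      "\<And>x y. x \<in> A \<Longrightarrow> y \<in> A \<Longrightarrow> T (sup x y) = sup (T x) (T y)"
      "\<And>x y. x \<in> A \<Longrightarrow> y \<in> A \<Longrightarrow> T (inf x y) = inf (T x) (T y)"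
    using assms(1) unfolding lattice_isomorphism_def by blast+
  define S where "S = inv_into A T"
  have S: "S u \<in> A" "T (S u) = u" if "u \<in> B" for u
    using bij that unfolding S_def by (auto simp: bij_betw_def inv_into_into f_inv_into_f)
  \<comment> \<open>Values of the inverse are recognized as preimages, so each identity for
    \<open>S\<close> is checked by applying \<open>T\<close>.\<close>
  have S_eq: "S u = x" if "x \<in> A" "T x = u" for u x
    using bij that unfolding S_def by (auto simp: bij_betw_def)
  have "S (u + v) = S u + S v" "S (sup u v) = sup (S u) (S v)" "S (inf u v) = inf (S u) (S v)"
    if "u \<in> B" "v \<in> B" for u v
    using that by (intro S_eq; simp add: S T vector_sublattice_closed[OF A])+
  moreover have "S (c *\<^sub>R u) = c *\<^sub>R S u" if "u \<in> B" for u c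
    using that by (intro S_eq; simp add: S T vector_sublattice_closed[OF A])
  ultimately show ?thesis
    using bij_betw_inv_into[OF bij] unfolding lattice_isomorphism_def S_def by blast
qed

locale dedekind_embedding = majorizing_sublattice X Y
  for X Y :: "'a::archimedean_vector_lattice set" +
  fixes J :: "'a \<Rightarrow> 'b::archimedean_vector_lattice" and D :: "'b set"
  assumes completion: "dedekind_completion X J D"
begin

lemma D: "vector_sublattice D"
  using completion unfolding dedekind_completion_def by blast

lemma J_mem: "x \<in> X \<Longrightarrow> J x \<in> D"
  using completion unfolding dedekind_completion_def by blast

lemma J_iso: "lattice_isomorphism J X (J ` X)"
  using completion unfolding dedekind_completion_def by blast

lemma J_add: "x \<in> X \<Longrightarrow> y \<in> X \<Longrightarrow> J (x + y) = J x + J y"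
  and J_scaleR: "x \<in> X \<Longrightarrow> J (c *\<^sub>R x) = c *\<^sub>R J x"
  and J_sup: "x \<in> X \<Longrightarrow> y \<in> X \<Longrightarrow> J (sup x y) = sup (J x) (J y)"
  using J_iso unfolding lattice_isomorphism_def by blast+

lemma J_0: "J 0 = 0"
  using J_scaleR[OF vector_sublattice_closed(1)[OF X], of 0] by simp

lemma J_minus: "x \<in> X \<Longrightarrow> J (- x) = - J x"
  using J_scaleR[of x "-1"] by simp

text \<open>The order is expressed by suprema, which the injective map \<open>J\<close> preserves;
  hence \<open>J\<close> also reflects it.\<close>

lemma J_le_iff: assumes "x \<in> X" "y \<in> X" shows "J x \<le> J y \<longleftrightarrow> x \<le> y"
proof -
  have "inj_on J X" using J_iso unfolding lattice_isomorphism_def bij_betw_def by blast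
  then have "J (sup x y) = J y \<longleftrightarrow> sup x y = y"
    using assms vector_sublattice_closed(6)[OF X] by (intro inj_on_eq_iff) auto
  then show ?thesis using J_sup[OF assms] by (simp add: le_iff_sup)
qed

section \<open>The extension \<open>T\<close> of \<open>J\<close> and its behaviour under shifts by
  \<open>X\<close>\<close>

definition T where "T z = (SOME s. isLub D (J ` {x \<in> X. x \<le> z}) s)"

lemma T_isLub:
  assumes "z \<in> Y"
  shows "isLub D (J ` {x \<in> X. x \<le> z}) (T z)"
proof -
  \<comment> \<open>One majorant does both jobs: \<open>J u\<close> bounds the set from above, and
    \<open>- u\<close> shows that it is nonempty.\<close>
  obtain u where u: "u \<in> X" "z \<le> u" "- u \<le> z" using majorant[OF assms] by blast
  have "J x \<le> J u" if "x \<in> X" "x \<le> z" for x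
    using that u J_le_iff order_trans by blast
  then have "isUb D (J ` {x \<in> X. x \<le> z}) (J u)"
    using J_mem[OF u(1)] by (intro isUbI setleI) auto
  moreover have "J ` {x \<in> X. x \<le> z} \<noteq> {}"
    using u vector_sublattice_closed(4)[OF X] by auto
  moreover have "J ` {x \<in> X. x \<le> z} \<subseteq> D" using J_mem by blast
  moreover have "dedekind_complete D"
    using completion unfolding dedekind_completion_def by blast
  ultimately have "\<exists>s. isLub D (J ` {x \<in> X. x \<le> z}) s"
    unfolding dedekind_complete_def by blast
  then show ?thesis unfolding T_def by (rule someI_ex)
qed

lemma T_mem: "z \<in> Y \<Longrightarrow> T z \<in> D"
  using T_isLub isLubD1a by blast

lemma T_upper: "z \<in> Y \<Longrightarrow> x \<in> X \<Longrightarrow> x \<le> z \<Longrightarrow> J x \<le> T z"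
  using T_isLub isLubD2 by blast

lemma T_least:
  assumes "z \<in> Y" "d \<in> D" "\<And>x. x \<in> X \<Longrightarrow> x \<le> z \<Longrightarrow> J x \<le> d"
  shows "T z \<le> d"
  using assms by (intro isLub_le_isUb[OF T_isLub] isUbI setleI) auto

lemma T_X: assumes "x \<in> X" shows "T x = J x"
proof (rule order_antisym)
  have "x \<in> Y" using assms XY by blast
  then show "T x \<le> J x" "J x \<le> T x"
    using T_least[of x "J x"] T_upper[of x x] J_mem J_le_iff assms by auto
qed

lemma T_mono: assumes "z \<in> Y" "w \<in> Y" "z \<le> w" shows "T z \<le> T w"
  by (rule T_least[OF assms(1) T_mem[OF assms(2)]])
    (use T_upper[OF assms(2)] assms(3) order_trans in blast)

lemma T_add_X: assumes z: "z \<in> Y" and x: "x \<in> X" shows "T (z + x) = T z + J x"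
proof (rule order_antisym)
  have le: "T (z + x) \<le> T z + J x" if z: "z \<in> Y" and x: "x \<in> X" for z x
  proof (rule T_least)
    show "z + x \<in> Y" using z x XY vector_sublattice_closed(2)[OF Y] by blast
    show "T z + J x \<in> D" using T_mem J_mem z x vector_sublattice_closed(2)[OF D] by blast
    fix u assume u: "u \<in> X" "u \<le> z + x"
    have ux: "u - x \<in> X" using u x vector_sublattice_closed(3)[OF X] by blast
    then have "J (u - x) \<le> T z" using T_upper[OF z] u by (simp add: diff_le_eq)
    moreover have "J u = J (u - x) + J x" using J_add[OF ux x] by simp
    ultimately show "J u \<le> T z + J x" by simp
  qed
  show "T (z + x) \<le> T z + J x" by (rule le[OF z x])
  have "z + x \<in> Y" using z x XY vector_sublattice_closed(2)[OF Y] by blast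
  \<comment> \<open>The reverse inequality is the one just proved, applied to \<open>z + x\<close>
    and the shift by \<open>- x\<close>.\<close>
  then have "T (z + x + - x) \<le> T (z + x) + J (- x)"
    by (rule le) (rule vector_sublattice_closed(4)[OF X x])
  then show "T z + J x \<le> T (z + x)" using J_minus[OF x] by (simp add: le_diff_eq)
qed

text \<open>Monotonicity and the shift rule for elements of \<open>X\<close> give this before
  \<open>T\<close> is known to be additive. It is the source of continuity, with regulator
  \<open>J e\<close>.\<close>

lemma T_le_shift:
  assumes "a \<in> Y" "b \<in> Y" "e \<in> X" "a \<le> b + \<epsilon> *\<^sub>R e"
  shows "T a \<le> T b + \<epsilon> *\<^sub>R J e"
proof -
  have e: "\<epsilon> *\<^sub>R e \<in> X" using assms(3) vector_sublattice_closed(5)[OF X] by blast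
  then have "b + \<epsilon> *\<^sub>R e \<in> Y" using assms(2) XY vector_sublattice_closed(2)[OF Y] by blast
  then have "T a \<le> T (b + \<epsilon> *\<^sub>R e)" using T_mono assms(1,4) by blast
  then show ?thesis using T_add_X[OF assms(2) e] J_scaleR[OF assms(3)] by simp
qed

lemma J_nonneg: "x \<in> X \<Longrightarrow> 0 \<le> x \<Longrightarrow> 0 \<le> J x"
  using J_le_iff[OF vector_sublattice_closed(1)[OF X]] J_0 by simp

lemma ru_continuous_on_T: "ru_continuous_on X Z D T"
  unfolding ru_continuous_on_def
proof (intro ballI impI)
  fix e assume e: "e \<in> X" "0 \<le> e"
  show "\<exists>e'\<in>D. 0 \<le> e' \<and> (\<forall>a\<in>Z. \<forall>b\<in>Z. \<forall>\<epsilon>>0. a \<le> b + \<epsilon> *\<^sub>R e \<longrightarrow> b \<le> a + \<epsilon> *\<^sub>R e \<longrightarrow>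
      T a \<le> T b + \<epsilon> *\<^sub>R e')"
    using Z_subset J_mem[OF e(1)] J_nonneg[OF e] T_le_shift[OF _ _ e(1)]
    by (intro bexI[of _ "J e"]) blast+
qed

section \<open>\<open>T\<close> as a lattice homomorphism on \<open>Z\<close>\<close>

lemma ru_continuous_on_T_compose:
  assumes "ru_continuous_on X Z X f" "\<And>z. z \<in> Z \<Longrightarrow> f z \<in> Z"
  shows "ru_continuous_on X Z D (\<lambda>z. T (f z))"
  by (rule ru_continuous_on_compose[OF assms(1) _ ru_continuous_on_T]) (use assms(2) in blast)

lemma ru_continuous_on_compose_T:
  assumes "ru_continuous_on D UNIV D g"
  shows "ru_continuous_on X Z D (\<lambda>z. g (T z))"
  by (rule ru_continuous_on_compose[OF ru_continuous_on_T _ assms]) blast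

text \<open>One passage to the limit suffices: for \<open>x\<close> in \<open>X\<close> the shift
  rule \<open>T_add_X\<close> already allows the other summand to be any \<open>w\<close> in
  \<open>Y\<close>.\<close>

lemma T_add: assumes "z \<in> Z" "w \<in> Z" shows "T (z + w) = T z + T w"
proof (rule eq_on_Z[OF _ _ _ assms(1)])
  show "ru_continuous_on X Z D (\<lambda>z. T (z + w))"
    by (rule ru_continuous_on_T_compose[OF ru_continuous_on_add]) (rule add_Z[OF _ assms(2)])
  show "ru_continuous_on X Z D (\<lambda>z. T z + T w)"
    by (rule ru_continuous_on_compose_T[OF ru_continuous_on_add])
  fix x assume "x \<in> X"
  then show "T (x + w) = T x + T w"
    using T_add_X[of w x] T_X[of x] assms(2) Z_subset by (simp add: add.commute subset_iff)
qed

lemma T_scaleR: assumes "z \<in> Z" shows "T (c *\<^sub>R z) = c *\<^sub>R T z"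
proof (rule eq_on_Z[OF _ _ _ assms])
  show "ru_continuous_on X Z D (\<lambda>z. T (c *\<^sub>R z))"
    by (rule ru_continuous_on_T_compose[OF ru_continuous_on_scaleR[OF X]]) (rule scaleR_Z)
  show "ru_continuous_on X Z D (\<lambda>z. c *\<^sub>R T z)"
    by (rule ru_continuous_on_compose_T[OF ru_continuous_on_scaleR[OF D]])
  fix x assume "x \<in> X"
  then show "T (c *\<^sub>R x) = c *\<^sub>R T x"
    using T_X J_scaleR vector_sublattice_closed(5)[OF X] by simp
qed

text \<open>Suprema have no counterpart of the shift rule, so the limit is taken in one argument at
  a time, starting from \<open>J_sup\<close> on \<open>X\<close>.\<close>

lemma T_sup: assumes "z \<in> Z" "w \<in> Z" shows "T (sup z w) = sup (T z) (T w)"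
proof -
  have cont: "ru_continuous_on X Z D (\<lambda>z. T (sup z w))" if "w \<in> Z" for w
    by (rule ru_continuous_on_T_compose[OF ru_continuous_on_sup]) (rule sup_Z[OF _ that])
  have cont': "ru_continuous_on X Z D (\<lambda>z. sup (T z) (T w))" for w
    by (rule ru_continuous_on_compose_T[OF ru_continuous_on_sup])
  have "T (sup z x) = sup (T z) (T x)" if z: "z \<in> Z" and x: "x \<in> X" for z x
  proof (rule eq_on_Z[OF cont cont' _ z])
    show "x \<in> Z" using x X_subset_Z by blast
    show "T (sup u x) = sup (T u) (T x)" if "u \<in> X" for u
      using that x J_sup T_X vector_sublattice_closed(6)[OF X] by simp
  qed
  \<comment> \<open>By commutativity, the identity with one argument in \<open>X\<close> becomes the
    base case for the second passage.\<close>
  then have "T (sup x w) = sup (T x) (T w)" if "x \<in> X" for x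
    using assms(2) that by (simp add: sup.commute)
  then show ?thesis
    by (rule eq_on_Z[OF cont[OF assms(2)] cont' _ assms(1)])
qed

lemma T_inf: assumes "z \<in> Z" "w \<in> Z" shows "T (inf z w) = inf (T z) (T w)"
proof -
  have neg: "- u \<in> Z" "T (- u) = - T u" if "u \<in> Z" for u
    using scaleR_Z[OF that, of "-1"] T_scaleR[OF that, of "-1"] by simp_all
  have "T (inf z w) = T (- sup (- z) (- w))" by (simp only: inf_eq_neg_sup)
  also have "\<dots> = - sup (- T z) (- T w)" by (simp only: neg T_sup sup_Z assms)
  finally show ?thesis by (simp only: inf_eq_neg_sup)
qed

text \<open>Order is reflected against elements of \<open>X\<close>, by induction over the closure:
  on \<open>X\<close> this is \<open>J_le_iff\<close>, and errors in the limit are absorbed by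
  shifting \<open>x\<close>.\<close>

lemma T_le_J_imp_le:
  assumes "z \<in> Z" "x \<in> X" "T z \<le> J x"
  shows "z \<le> x"
proof -
  \<comment> \<open>The bound is quantified inside the induction because the limit case applies the
    hypothesis to a shifted \<open>x\<close>.\<close>
  have "\<forall>x\<in>X. T z \<le> J x \<longrightarrow> z \<le> x"
    using assms(1)
  proof (induction rule: closure_induct)
    case (base x)
    then show ?case using T_X J_le_iff by simp
  next
    case (limit e l)
    show ?case
    proof (intro ballI impI)
      fix x assume x: "x \<in> X" "T l \<le> J x"
      \<comment> \<open>One \<open>e\<close> pays for shifting \<open>x\<close> in the estimate of
        \<open>T c\<close>, the other for passing from \<open>c\<close> back to
        \<open>l\<close>.\<close>
      have "l \<le> x + \<epsilon> *\<^sub>R (e + e)" if \<epsilon>: "0 < \<epsilon>" for \<epsilon>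
      proof -
        obtain c where c: "c \<in> Z" "\<forall>x\<in>X. T c \<le> J x \<longrightarrow> c \<le> x"
          "c \<le> l + \<epsilon> *\<^sub>R e" "l \<le> c + \<epsilon> *\<^sub>R e"
          using approximable_obtain[OF limit(4) \<epsilon>] by blast
        have e: "\<epsilon> *\<^sub>R e \<in> X" using limit(1) vector_sublattice_closed(5)[OF X] by blast
        have "T c \<le> T l + \<epsilon> *\<^sub>R J e"
          using T_le_shift c(1,3) limit(1,3) Z_subset by blast
        also have "\<dots> \<le> J x + \<epsilon> *\<^sub>R J e" using x(2) by simp
        also have "\<dots> = J (x + \<epsilon> *\<^sub>R e)" using J_add[OF x(1) e] J_scaleR[OF limit(1)] by simp
        finally have "c \<le> x + \<epsilon> *\<^sub>R e"
          using c(2) vector_sublattice_closed(2)[OF X x(1) e] by blast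
        then have "l \<le> (x + \<epsilon> *\<^sub>R e) + \<epsilon> *\<^sub>R e"
          using c(4) by (meson add_right_mono order_trans)
        then show ?thesis by (simp add: scaleR_add_right add.assoc)
      qed
      moreover have "0 \<le> e + e" using limit(2) by simp
      ultimately show "l \<le> x" by (rule archimedean_le[rotated])
    qed
  qed
  then show ?thesis using assms(2,3) by blast
qed

section \<open>Injectivity of \<open>T\<close>\<close>

lemma T_diff: assumes "z \<in> Z" "w \<in> Z" shows "T (z - w) = T z - T w"
  using T_add[OF assms(1) scaleR_Z[OF assms(2), of "-1"]] T_scaleR[OF assms(2), of "-1"] by simp

lemma diff_Z: "z \<in> Z \<Longrightarrow> w \<in> Z \<Longrightarrow> z - w \<in> Z"
  by (rule vector_sublattice_closed(3)[OF vector_sublattice_Z])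

lemma T_abs_diff: assumes "z \<in> Z" "w \<in> Z" shows "T \<bar>z - w\<bar> = \<bar>T z - T w\<bar>"
  using T_sup[OF diff_Z[OF assms] diff_Z[OF assms(2,1)]] assms
  by (simp add: abs_lattice T_diff)

text \<open>Equal images give \<open>T (z - w) = J 0\<close>, and order reflection at 0 yields one
  inequality; exchanging \<open>z\<close> and \<open>w\<close> yields the other.\<close>

lemma inj_on_T: "inj_on T Z"
proof (rule inj_onI)
  have le: "z \<le> w" if "z \<in> Z" "w \<in> Z" "T z = T w" for z w
    using T_le_J_imp_le[OF diff_Z[OF that(1,2)] vector_sublattice_closed(1)[OF X]] that
    by (simp add: T_diff J_0)
  fix z w assume "z \<in> Z" "w \<in> Z" "T z = T w"
  then show "z = w" using le[of z w] le[of w z] by simp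
qed

lemma lattice_isomorphism_T: "lattice_isomorphism T Z (T ` Z)"
  unfolding lattice_isomorphism_def
  using inj_on_T by (simp add: bij_betw_def T_add T_scaleR T_sup T_inf)

section \<open>The image of \<open>Z\<close> under \<open>T\<close> as the uniform
  completion\<close>

lemma vector_sublattice_T_Z: "vector_sublattice (T ` Z)"
proof -
  note Z_closed = vector_sublattice_closed[OF vector_sublattice_Z]
  have "0 \<in> T ` Z"
    using T_X[OF vector_sublattice_closed(1)[OF X]] J_0 imageI[OF Z_closed(1), of T] by simp
  moreover have "T z + T w \<in> T ` Z" "c *\<^sub>R T z \<in> T ` Z" "sup (T z) (T w) \<in> T ` Z"
    "inf (T z) (T w) \<in> T ` Z" if zw: "z \<in> Z" "w \<in> Z" for z w c
    using imageI[OF Z_closed(2)[OF zw], of T] imageI[OF Z_closed(5)[OF zw(1)], of T c]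
      imageI[OF Z_closed(6)[OF zw], of T] imageI[OF Z_closed(7)[OF zw], of T]
    by (simp_all only: T_add[OF zw] T_scaleR[OF zw(1)] T_sup[OF zw] T_inf[OF zw])
  ultimately show ?thesis
    unfolding vector_sublattice_def by (auto intro!: subspaceI)
qed

text \<open>A Cauchy net is pulled back to \<open>Z\<close>, where order reflection keeps it Cauchy.
  Its limit in \<open>Y\<close> lies in \<open>Z\<close> by closedness and is carried back by
  \<open>T\<close>.\<close>

lemma uniformly_complete_T_Z:
  assumes "uniformly_complete Y"
  shows "uniformly_complete (T ` Z)"
  unfolding uniformly_complete_def
proof (intro allI impI)
  fix I :: "('b \<times> 'b set) set" and r y
  assume net: "directed_set I r \<and> y ` I \<subseteq> T ` Z \<and> uniformly_Cauchy_in (T ` Z) I r y"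
  then have dir: "directed_set I r" by blast
  define z where "z a = inv_into Z T (y a)" for a
  have z: "z a \<in> Z" "T (z a) = y a" if "a \<in> I" for a
    using net that unfolding z_def by (auto simp: inv_into_into f_inv_into_f image_subset_iff)
  obtain w where w: "w \<in> Z" and cauchy: "\<And>\<epsilon>. 0 < \<epsilon> \<Longrightarrow>
      \<exists>a\<in>I. \<forall>b\<in>I. \<forall>c\<in>I. r a b \<longrightarrow> r a c \<longrightarrow> \<bar>y b - y c\<bar> \<le> \<epsilon> *\<^sub>R T w"
    using net unfolding uniformly_Cauchy_in_iff[OF dir] by blast
  \<comment> \<open>Order reflection compares only with elements of \<open>X\<close>, so the
    regulator \<open>T w\<close> is first enlarged to \<open>J e\<close>.\<close>
  obtain e where e: "e \<in> X" "0 \<le> e" "w \<le> e" using majorant[of w] w Z_subset by blast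
  have we: "T w \<le> J e" using T_mono[of w e] e w Z_subset XY T_X by fastforce
  have "uniformly_Cauchy_in Y I r z"
    unfolding uniformly_Cauchy_in_iff[OF dir]
  proof (intro conjI bexI[of _ e] allI impI)
    fix \<epsilon> :: real assume \<epsilon>: "0 < \<epsilon>"
    obtain a where a: "a \<in> I"
      "\<And>b c. b \<in> I \<Longrightarrow> c \<in> I \<Longrightarrow> r a b \<Longrightarrow> r a c \<Longrightarrow> \<bar>y b - y c\<bar> \<le> \<epsilon> *\<^sub>R T w"
      using cauchy[OF \<epsilon>] by blast
    have "\<bar>z b - z c\<bar> \<le> \<epsilon> *\<^sub>R e" if "b \<in> I" "c \<in> I" "r a b" "r a c" for b c
    proof (rule T_le_J_imp_le)
      show "\<bar>z b - z c\<bar> \<in> Z"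
        using z that by (intro vector_sublattice_closed(8)[OF vector_sublattice_Z] diff_Z)
      show "\<epsilon> *\<^sub>R e \<in> X" using e vector_sublattice_closed(5)[OF X] by blast
      have "T \<bar>z b - z c\<bar> = \<bar>y b - y c\<bar>" using z that by (simp add: T_abs_diff)
      also have "\<dots> \<le> \<epsilon> *\<^sub>R T w" using a(2) that by blast
      also have "\<dots> \<le> \<epsilon> *\<^sub>R J e" using we \<epsilon> by (simp add: scaleR_left_mono)
      finally show "T \<bar>z b - z c\<bar> \<le> J (\<epsilon> *\<^sub>R e)" using J_scaleR[OF e(1)] by simp
    qed
    then show "\<exists>a\<in>I. \<forall>b\<in>I. \<forall>c\<in>I. r a b \<longrightarrow> r a c \<longrightarrow> \<bar>z b - z c\<bar> \<le> \<epsilon> *\<^sub>R e"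
      using a(1) by blast
  qed (use e XY vector_sublattice_closed(1)[OF Y] in auto)
  moreover have "z ` I \<subseteq> Y" using z Z_subset by blast
  ultimately obtain l where lim: "converges_uniformly_in Y I r z l"
    using uniformly_completeD[OF assms dir] by blast
  have l: "l \<in> Z" using uniformly_closedD[OF closed_Z dir _ lim] z by blast
  obtain v where v: "v \<in> Y" "converges_relative_to v I r z l"
    using lim unfolding converges_uniformly_in_def by blast
  \<comment> \<open>Enlarging the regulator into \<open>X\<close> puts its image \<open>J x\<close>
    into the image of \<open>Z\<close>, as intrinsic convergence demands.\<close>
  obtain x where x: "x \<in> X" "0 \<le> x" "v \<le> x" using majorant[OF v(1)] by blast
  have "converges_relative_to (J x) I r y (T l)"
    unfolding converges_relative_to_def
  proof (intro allI impI)
    fix \<epsilon> :: real assume \<epsilon>: "0 < \<epsilon>"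
    obtain a where a: "a \<in> I" "\<And>b. b \<in> I \<Longrightarrow> r a b \<Longrightarrow> \<bar>z b - l\<bar> \<le> \<epsilon> *\<^sub>R v"
      using v(2) \<epsilon> unfolding converges_relative_to_def by blast
    have "\<bar>y b - T l\<bar> \<le> \<epsilon> *\<^sub>R J x" if "b \<in> I" "r a b" for b
    proof -
      have "\<epsilon> *\<^sub>R v \<le> \<epsilon> *\<^sub>R x" using x(3) \<epsilon> by (simp add: scaleR_left_mono)
      then have "\<bar>z b - l\<bar> \<le> \<epsilon> *\<^sub>R x" using a(2)[OF that] order_trans by blast
      then have "z b \<le> l + \<epsilon> *\<^sub>R x" "l \<le> z b + \<epsilon> *\<^sub>R x" unfolding abs_diff_le_iff_both by auto
      then have "T (z b) \<le> T l + \<epsilon> *\<^sub>R J x" "T l \<le> T (z b) + \<epsilon> *\<^sub>R J x"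
        using T_le_shift[OF _ _ x(1)] z(1)[OF that(1)] l Z_subset by blast+
      then show ?thesis unfolding abs_diff_le_iff_both using z(2)[OF that(1)] by simp
    qed
    then show "\<exists>a\<in>I. \<forall>b\<in>I. r a b \<longrightarrow> \<bar>y b - T l\<bar> \<le> \<epsilon> *\<^sub>R J x" using a(1) by blast
  qed
  moreover have "J x \<in> T ` Z" using T_X[OF x(1)] x(1) X_subset_Z by force
  ultimately show "\<exists>l. converges_uniformly_in (T ` Z) I r y l"
    unfolding converges_uniformly_in_def using l J_nonneg[OF x(1,2)] by blast
qed

text \<open>In the limit case the regulator \<open>J e\<close> belongs to \<open>S\<close>, because
  \<open>S\<close> contains the image of \<open>X\<close>; completeness of \<open>S\<close> then
  captures \<open>T l\<close>.\<close>

lemma T_Z_least: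
  assumes S: "vector_sublattice S" "uniformly_complete S" and JS: "J ` X \<subseteq> S" and z: "z \<in> Z"
  shows "T z \<in> S"
  using z
proof (induction rule: closure_induct)
  case (base x)
  then show ?case using T_X JS by auto
next
  case (limit e l)
  have "approximable (J e) S (T l)"
    unfolding approximable_def
  proof (intro allI impI)
    fix \<epsilon> :: real assume \<epsilon>: "0 < \<epsilon>"
    obtain c where c: "c \<in> Z" "T c \<in> S" "c \<le> l + \<epsilon> *\<^sub>R e" "l \<le> c + \<epsilon> *\<^sub>R e"
      using approximable_obtain[OF limit(4) \<epsilon>] by blast
    then have "T c \<le> T l + \<epsilon> *\<^sub>R J e" "T l \<le> T c + \<epsilon> *\<^sub>R J e"
      using T_le_shift[OF _ _ limit(1)] limit(3) Z_subset by blast+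
    then show "\<exists>d\<in>S. d \<le> T l + \<epsilon> *\<^sub>R J e \<and> T l \<le> d + \<epsilon> *\<^sub>R J e" using c(2) by blast
  qed
  then show ?case
    using uniformly_complete_approximable[OF S] J_nonneg limit(1,2) JS by blast
qed

text \<open>The image of \<open>Z\<close> is itself a member of the family being intersected, and
  \<open>T_Z_least\<close> places it inside every member.\<close>

lemma uniform_completion_eq:
  assumes "uniformly_complete Y"
  shows "uniform_completion_in D (J ` X) = T ` Z"
proof
  have "J ` X \<subseteq> T ` Z" using T_X X_subset_Z by force
  moreover have "T ` Z \<subseteq> D" using T_mem Z_subset by blast
  ultimately show "uniform_completion_in D (J ` X) \<subseteq> T ` Z"
    unfolding uniform_completion_in_def
    using vector_sublattice_T_Z uniformly_complete_T_Z[OF assms] by blast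
  show "T ` Z \<subseteq> uniform_completion_in D (J ` X)"
    unfolding uniform_completion_in_def using T_Z_least by blast
qed

end

theorem corollary6p2:
  fixes X Y :: "'a::archimedean_vector_lattice set"
    and D :: "'b::archimedean_vector_lattice set"
    and J :: "'a \<Rightarrow> 'b"
  assumes "vector_sublattice Y"
    and "uniformly_complete Y"
    and "vector_sublattice X"
    and "X \<subseteq> Y"
    and "majorizing X Y"
    and "dedekind_completion X J D"
  shows "lattice_isomorphic (uniform_completion_in D (J ` X)) (uniform_closure_in Y X)"
proof -
  interpret dedekind_embedding X Y J D
    using assms by unfold_locales
  show ?thesis
    unfolding lattice_isomorphic_def uniform_completion_eq[OF assms(2)] Z_def[symmetric]
    using lattice_isomorphism_inv_into[OF lattice_isomorphism_T vector_sublattice_Z] by blast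
qed

end
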